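(* Let $G\rightrightarrows G_0$ and $H\rightrightarrows H_0$ be two Morita equivalent diffeological groupoids. Then $G\rightrightarrows G_0$ is fibrating if and only if $H\rightrightarrows H_0$ is fibrating.
   Context: Diffeology. A Euclidean domain is an open subset of some $\mathbb{R}^m$, $m\geq 0$. A diffeology on a set $X$ is a set of functions from Euclidean domains to $X$, called plots, such that: all constant functions are plots; if $\alpha:U\to X$ is a plot and $h:V\to U$ is a smooth map between Euclidean domains, then $\alpha\circ h$ is a plot; a function $\alpha:U\to X$ whose restriction to each member of some open cover of $U$ is a plot is itself a plot. A diffeological space is a set with a diffeology. A function $f$ between diffeological spaces is smooth if $f\circ\alpha$ is a plot for every plot $\alpha$; a diffeomorphism is a smooth bijection with smooth inverse. The plots of a product are the functions whose two components are plots; the plots of a subset are the functions into it that are plots of the ambient space; the fibred product $X\times_Z^{f,g}Y=\{(x,y)\in X\times Y: f(x)=g(y)\}$ has the subset diffeology of the product. A subduction is a smooth surjection $f:X\to Y$ such that for every plot $\alpha:U\to Y$ and $t\in U$ there are an open neighbourhood $V\subseteq U$ of $t$ and a plot $\beta:V\to X$ with $\alpha|_V=f\circ\beta$. Diffeological groupoids. A diffeological groupoid $G\rightrightarrows G_0$ is a groupoid whose object set $G_0$ and arrow set $G$ are diffeological spaces such that source $\mathrm{src}$, target $\mathrm{trg}$, unit $x\mapsto \mathrm{id}_x$, inversion and composition $G\times_{G_0}^{\mathrm{src},\mathrm{trg}}G\to G$, $(g,h)\mapsto g\circ h$, are smooth. It is fibrating if the map $(\mathrm{trg},\mathrm{src}):G\to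 G_0\times G_0$ is a subduction. Actions. A smooth left action of $G$ on a diffeological space $X$ along a smooth map $l_X:X\to G_0$ (left moment map) is a smooth map $G\times_{G_0}^{\mathrm{src},l_X}X\to X$, $(g,x)\mapsto gx$, with $l_X(gx)=\mathrm{trg}(g)$, $\mathrm{id}_{l_X(x)}x=x$ and $h(gx)=(h\circ g)x$ whenever defined. A smooth right action of $H$ on $X$ along $r_X:X\to H_0$ (right moment map) is a smooth map $X\times_{H_0}^{r_X,\mathrm{trg}}H\to X$, $(x,h)\mapsto xh$, with $r_X(xh)=\mathrm{src}(h)$, $x\,\mathrm{id}_{r_X(x)}=x$ and $(xh)h'=x(h\circ h')$ whenever defined. Bibundles and Morita equivalence. A diffeological $(G,H)$-bibundle is a diffeological space $X$ with a smooth left $G$-action along $l_X$ and a smooth right $H$-action along $r_X$ such that $l_X(xh)=l_X(x)$, $r_X(gx)=r_X(x)$ and $(gx)h=g(xh)$ whenever defined. It is biprincipal if $l_X:X\to G_0$ and $r_X:X\to H_0$ are both subductions and both action maps $G\times_{G_0}^{\mathrm{src},l_X}X\to X\times_{H_0}^{r_X,r_X}X$, $(g,x)\mapsto(gx,x)$, and $X\times_{H_0}^{r_X,\mathrm{trg}}H\to X\times_{G_0}^{l_X,l_X}X$, $(x,h)\mapsto(x,xh)$, are diffeomorphisms. $G$ and $H$ are Morita equivalent if there exists a biprincipal $(G,H)$-bibundle. *)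

theory Defs
  imports "HOL-Analysis.Analysis"
begin

section \<open>Smooth maps between Euclidean domains\<close>

text \<open>
  The dimension of a Euclidean domain varies, so \<open>\<real>\<^sup>m\<close> is the library space
  \<^const>\<open>Euclidean_space\<close> \<open>m\<close>: sequences \<open>nat \<Rightarrow> real\<close> that vanish from index \<open>m\<close> on.
\<close>

abbreviation euclidean_domain :: "nat \<Rightarrow> (nat \<Rightarrow> real) set \<Rightarrow> bool" where
  "euclidean_domain m U \<equiv> openin (Euclidean_space m) U"

text \<open>
  \<open>f\<close> is of class \<open>C\<^sup>k\<close> on the open set \<open>U\<close> of \<open>\<real>\<^sup>m\<close>: all iterated partial derivatives of order
  at most \<open>k\<close> exist and are continuous. The function \<open>g\<close> below is the \<open>i\<close>-th partial derivative
  of \<open>f\<close>, which on \<open>U\<close> is unique.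
\<close>

primrec Ck_on :: "nat \<Rightarrow> nat \<Rightarrow> (nat \<Rightarrow> real) set \<Rightarrow> ((nat \<Rightarrow> real) \<Rightarrow> real) \<Rightarrow> bool" where
  "Ck_on m 0 U f \<longleftrightarrow>
     continuous_map (subtopology (Euclidean_space m) U) euclideanreal f"
| "Ck_on m (Suc k) U f \<longleftrightarrow>
     continuous_map (subtopology (Euclidean_space m) U) euclideanreal f \<and>
     (\<forall>i<m. \<exists>g. (\<forall>x\<in>U. ((\<lambda>t. f (x(i := t))) has_real_derivative g x) (at (x i))) \<and>
                Ck_on m k U g)"

definition smooth_euclidean ::
  "nat \<Rightarrow> (nat \<Rightarrow> real) set \<Rightarrow> nat \<Rightarrow> (nat \<Rightarrow> real) set \<Rightarrow> ((nat \<Rightarrow> real) \<Rightarrow> nat \<Rightarrow> real) \<Rightarrow> bool" where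
  "smooth_euclidean n V m U h \<longleftrightarrow>
     h \<in> V \<rightarrow> U \<and> (\<forall>j<m. \<forall>k. Ck_on n k V (\<lambda>v. h v j))"


section \<open>Diffeological spaces\<close>

text \<open>
  \<open>plots X m U\<close> is the set of plots of \<open>X\<close> with domain the open set \<open>U\<close> of \<open>\<real>\<^sup>m\<close>. A plot is a
  function on \<open>U\<close> only, hence is represented by an extensional function
  (\<^const>\<open>undefined\<close> outside \<open>U\<close>).
\<close>

record 'a diffeology =
  pts :: "'a set"
  plots :: "nat \<Rightarrow> (nat \<Rightarrow> real) set \<Rightarrow> ((nat \<Rightarrow> real) \<Rightarrow> 'a) set"

locale diffeological_space =
  fixes X :: "'a diffeology"
  assumes plot_domain: "\<alpha> \<in> plots X m U \<Longrightarrow> euclidean_domain m U"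
    and plot_fun: "\<alpha> \<in> plots X m U \<Longrightarrow> \<alpha> \<in> U \<rightarrow>\<^sub>E pts X"
    and plot_const: "\<lbrakk>euclidean_domain m U; x \<in> pts X\<rbrakk> \<Longrightarrow> (\<lambda>u\<in>U. x) \<in> plots X m U"
    and plot_comp: "\<lbrakk>\<alpha> \<in> plots X m U; euclidean_domain n V; smooth_euclidean n V m U h\<rbrakk>
        \<Longrightarrow> (\<lambda>v\<in>V. \<alpha> (h v)) \<in> plots X n V"
    and plot_local: "\<lbrakk>euclidean_domain m U; \<alpha> \<in> U \<rightarrow>\<^sub>E pts X; \<Union>\<V> = U;
        \<And>V. V \<in> \<V> \<Longrightarrow> euclidean_domain m V;
        \<And>V. V \<in> \<V> \<Longrightarrow> restrict \<alpha> V \<in> plots X m V\<rbrakk>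
        \<Longrightarrow> \<alpha> \<in> plots X m U"

definition dsmooth :: "'a diffeology \<Rightarrow> 'b diffeology \<Rightarrow> ('a \<Rightarrow> 'b) \<Rightarrow> bool" where
  "dsmooth X Y f \<longleftrightarrow>
     f \<in> pts X \<rightarrow> pts Y \<and>
     (\<forall>m U. \<forall>\<alpha>\<in>plots X m U. (\<lambda>u\<in>U. f (\<alpha> u)) \<in> plots Y m U)"

definition diffeomorphism :: "'a diffeology \<Rightarrow> 'b diffeology \<Rightarrow> ('a \<Rightarrow> 'b) \<Rightarrow> bool" where
  "diffeomorphism X Y f \<longleftrightarrow>
     bij_betw f (pts X) (pts Y) \<and> dsmooth X Y f \<and> dsmooth Y X (inv_into (pts X) f)"

definition subduction :: "'a diffeology \<Rightarrow> 'b diffeology \<Rightarrow> ('a \<Rightarrow> 'b) \<Rightarrow> bool" where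
  "subduction X Y f \<longleftrightarrow>
     dsmooth X Y f \<and> f ` pts X = pts Y \<and>
     (\<forall>m U. \<forall>\<alpha>\<in>plots Y m U. \<forall>t\<in>U.
        \<exists>V \<beta>. euclidean_domain m V \<and> t \<in> V \<and> V \<subseteq> U \<and> \<beta> \<in> plots X m V \<and>
              (\<forall>v\<in>V. \<alpha> v = f (\<beta> v)))"

definition prod_diff :: "'a diffeology \<Rightarrow> 'b diffeology \<Rightarrow> ('a \<times> 'b) diffeology" where
  "prod_diff X Y =
     \<lparr>pts = pts X \<times> pts Y,
      plots = (\<lambda>m U. {\<alpha> \<in> U \<rightarrow>\<^sub>E pts X \<times> pts Y.
         (\<lambda>u\<in>U. fst (\<alpha> u)) \<in> plots X m U \<and> (\<lambda>u\<in>U. snd (\<alpha> u)) \<in> plots Y m U})\<rparr>"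

definition sub_diff :: "'a diffeology \<Rightarrow> 'a set \<Rightarrow> 'a diffeology" where
  "sub_diff X S =
     \<lparr>pts = pts X \<inter> S,
      plots = (\<lambda>m U. {\<alpha> \<in> plots X m U. \<alpha> ` U \<subseteq> S})\<rparr>"

definition fibred_prod ::
  "'a diffeology \<Rightarrow> 'b diffeology \<Rightarrow> ('a \<Rightarrow> 'c) \<Rightarrow> ('b \<Rightarrow> 'c) \<Rightarrow> ('a \<times> 'b) diffeology" where
  "fibred_prod X Y f g = sub_diff (prod_diff X Y) {(x, y). f x = g y}"


section \<open>Diffeological groupoids\<close>

record ('o, 'a) groupoid =
  Ob :: "'o diffeology"
  Arr :: "'a diffeology"
  src :: "'a \<Rightarrow> 'o"
  trg :: "'a \<Rightarrow> 'o"
  unit :: "'o \<Rightarrow> 'a"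
  ginv :: "'a \<Rightarrow> 'a"
  comp :: "'a \<Rightarrow> 'a \<Rightarrow> 'a"

text \<open>\<open>comp G g h\<close> is \<open>g \<circ> h\<close>, meaningful when \<open>src G g = trg G h\<close>.\<close>

locale diffeological_groupoid =
  fixes G :: "('o, 'a) groupoid"
  assumes Ob_diff: "diffeological_space (Ob G)"
    and Arr_diff: "diffeological_space (Arr G)"
    and src_smooth: "dsmooth (Arr G) (Ob G) (src G)"
    and trg_smooth: "dsmooth (Arr G) (Ob G) (trg G)"
    and unit_smooth: "dsmooth (Ob G) (Arr G) (unit G)"
    and inv_smooth: "dsmooth (Arr G) (Arr G) (ginv G)"
    and comp_smooth:
      "dsmooth (fibred_prod (Arr G) (Arr G) (src G) (trg G)) (Arr G) (\<lambda>(g, h). comp G g h)"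
    and src_unit: "x \<in> pts (Ob G) \<Longrightarrow> src G (unit G x) = x"
    and trg_unit: "x \<in> pts (Ob G) \<Longrightarrow> trg G (unit G x) = x"
    and src_comp: "\<lbrakk>g \<in> pts (Arr G); h \<in> pts (Arr G); src G g = trg G h\<rbrakk>
        \<Longrightarrow> src G (comp G g h) = src G h"
    and trg_comp: "\<lbrakk>g \<in> pts (Arr G); h \<in> pts (Arr G); src G g = trg G h\<rbrakk>
        \<Longrightarrow> trg G (comp G g h) = trg G g"
    and comp_assoc: "\<lbrakk>g \<in> pts (Arr G); h \<in> pts (Arr G); k \<in> pts (Arr G);
          src G g = trg G h; src G h = trg G k\<rbrakk>
        \<Longrightarrow> comp G (comp G g h) k = comp G g (comp G h k)"
    and comp_unit_left: "g \<in> pts (Arr G) \<Longrightarrow> comp G (unit G (trg G g)) g = g"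
    and comp_unit_right: "g \<in> pts (Arr G) \<Longrightarrow> comp G g (unit G (src G g)) = g"
    and src_inv: "g \<in> pts (Arr G) \<Longrightarrow> src G (ginv G g) = trg G g"
    and trg_inv: "g \<in> pts (Arr G) \<Longrightarrow> trg G (ginv G g) = src G g"
    and comp_inv_left: "g \<in> pts (Arr G) \<Longrightarrow> comp G (ginv G g) g = unit G (src G g)"
    and comp_inv_right: "g \<in> pts (Arr G) \<Longrightarrow> comp G g (ginv G g) = unit G (trg G g)"

definition fibrating :: "('o, 'a) groupoid \<Rightarrow> bool" where
  "fibrating G \<longleftrightarrow> subduction (Arr G) (prod_diff (Ob G) (Ob G)) (\<lambda>g. (trg G g, src G g))"


section \<open>Bibundles and Morita equivalence\<close>

locale smooth_left_action = diffeological_groupoid G + diffeological_space X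
  for G :: "('o, 'a) groupoid" and X :: "'x diffeology" +
  fixes l :: "'x \<Rightarrow> 'o" and act :: "'a \<Rightarrow> 'x \<Rightarrow> 'x"
  assumes moment_smooth: "dsmooth X (Ob G) l"
    and act_smooth: "dsmooth (fibred_prod (Arr G) X (src G) l) X (\<lambda>(g, x). act g x)"
    and moment_act: "\<lbrakk>g \<in> pts (Arr G); x \<in> pts X; src G g = l x\<rbrakk> \<Longrightarrow> l (act g x) = trg G g"
    and act_unit: "x \<in> pts X \<Longrightarrow> act (unit G (l x)) x = x"
    and act_comp: "\<lbrakk>g \<in> pts (Arr G); h \<in> pts (Arr G); x \<in> pts X; src G g = l x; src G h = trg G g\<rbrakk>
        \<Longrightarrow> act h (act g x) = act (comp G h g) x"

locale smooth_right_action = diffeological_groupoid H + diffeological_space X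
  for H :: "('o, 'a) groupoid" and X :: "'x diffeology" +
  fixes r :: "'x \<Rightarrow> 'o" and act :: "'x \<Rightarrow> 'a \<Rightarrow> 'x"
  assumes moment_smooth: "dsmooth X (Ob H) r"
    and act_smooth: "dsmooth (fibred_prod X (Arr H) r (trg H)) X (\<lambda>(x, h). act x h)"
    and moment_act: "\<lbrakk>x \<in> pts X; h \<in> pts (Arr H); r x = trg H h\<rbrakk> \<Longrightarrow> r (act x h) = src H h"
    and act_unit: "x \<in> pts X \<Longrightarrow> act x (unit H (r x)) = x"
    and act_comp: "\<lbrakk>x \<in> pts X; h \<in> pts (Arr H); k \<in> pts (Arr H); r x = trg H h; src H h = trg H k\<rbrakk>
        \<Longrightarrow> act (act x h) k = act x (comp H h k)"

locale bibundle =
  left: smooth_left_action G X l lact + right: smooth_right_action H X r ract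
  for G :: "('o, 'a) groupoid" and H :: "('p, 'b) groupoid" and X :: "'x diffeology"
    and l :: "'x \<Rightarrow> 'o" and lact :: "'a \<Rightarrow> 'x \<Rightarrow> 'x"
    and r :: "'x \<Rightarrow> 'p" and ract :: "'x \<Rightarrow> 'b \<Rightarrow> 'x" +
  assumes left_moment_invariant: "\<lbrakk>x \<in> pts X; h \<in> pts (Arr H); r x = trg H h\<rbrakk>
        \<Longrightarrow> l (ract x h) = l x"
    and right_moment_invariant: "\<lbrakk>g \<in> pts (Arr G); x \<in> pts X; src G g = l x\<rbrakk>
        \<Longrightarrow> r (lact g x) = r x"
    and actions_commute: "\<lbrakk>g \<in> pts (Arr G); x \<in> pts X; h \<in> pts (Arr H);
          src G g = l x; r x = trg H h\<rbrakk>
        \<Longrightarrow> ract (lact g x) h = lact g (ract x h)"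

locale biprincipal_bibundle = bibundle +
  assumes left_subduction: "subduction X (Ob G) l"
    and right_subduction: "subduction X (Ob H) r"
    and left_principal: "diffeomorphism (fibred_prod (Arr G) X (src G) l) (fibred_prod X X r r)
          (\<lambda>(g, x). (lact g x, x))"
    and right_principal: "diffeomorphism (fibred_prod X (Arr H) r (trg H)) (fibred_prod X X l l)
          (\<lambda>(x, h). (x, ract x h))"

text \<open>
  HOL cannot quantify existentially over types, so the type \<open>'x\<close> in which the total space of the
  bibundle lives is a parameter. Leaving \<open>'x\<close> free in a hypothesis
  \<open>morita_equivalent TYPE('x) G H\<close> allows total spaces of arbitrary type.
\<close>

definition morita_equivalent ::
  "'x itself \<Rightarrow> ('o, 'a) groupoid \<Rightarrow> ('p, 'b) groupoid \<Rightarrow> bool" where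
  "morita_equivalent _ G H \<longleftrightarrow>
     (\<exists>(X :: 'x diffeology) l lact r ract. biprincipal_bibundle G H X l lact r ract)"

end

theory Submission
  imports Defs
begin

text \<open>
  A groupoid is fibrating iff any two plots of objects on a common domain are, near each point,
  the target and source of a plot of arrows. A biprincipal bibundle \<open>X\<close> carries this property
  from \<open>G\<close> to \<open>H\<close>. Near a given point, two plots of objects of \<open>H\<close> lift along the subduction
  \<open>r\<close> to plots \<open>a\<close>, \<open>b\<close> of \<open>X\<close>. As \<open>G\<close> is fibrating, the plots \<open>l \<circ> a\<close> and \<open>l \<circ> b\<close> are, on a
  smaller neighbourhood, the target and source of a plot \<open>g\<close> of arrows. Then \<open>g b\<close> has the same
  right moment as \<open>b\<close> but lies in the same \<open>l\<close>-fibre as \<open>a\<close>, so that principality of the right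
  action divides \<open>g b\<close> by \<open>a\<close>: there is a smooth \<open>h\<close> with \<open>a h = g b\<close>, and \<open>h\<close> joins the two
  plots of objects of \<open>H\<close>.

  The argument uses only that points of \<open>X\<close> can be moved smoothly along arrows of one groupoid and
  divided smoothly to give arrows of the other. Both groupoids provide both operations (after
  inverting arrows on the right), so it is stated once, in
  \<open>fibrating_transfer\<close>, and applied in both directions.
\<close>

section \<open>Plots\<close>

text \<open>
  Plots restrict to smaller open sets because inclusions of Euclidean domains are smooth; the next
  two lemmas supply the partial derivatives of the coordinates.
\<close>

lemma Ck_on_const: "Ck_on m k U (\<lambda>x. c)"
proof (induction k arbitrary: c)
  case 0
  then show ?case by simp
next
  case (Suc k)
  have "((\<lambda>t. c) has_real_derivative 0) (at s)" for s :: real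
    by simp
  with Suc.IH[of 0] Suc.IH[of c] show ?case
    by (auto intro!: exI[of _ "\<lambda>x. 0"])
qed

lemma Ck_on_coordinate: "Ck_on m k U (\<lambda>x. x j)"
proof -
  have cont: "continuous_map (subtopology (Euclidean_space m) U) euclideanreal (\<lambda>x. x j)"
    unfolding Euclidean_space_def
    by (intro continuous_map_from_subtopology continuous_map_product_projection) auto
  show ?thesis
  proof (cases k)
    case 0
    with cont show ?thesis by simp
  next
    case (Suc n)
    have "((\<lambda>t. (x(i := t)) j) has_real_derivative (if i = j then 1 else 0)) (at s)"
      for i s and x :: "nat \<Rightarrow> real"
      by simp
    then have "\<exists>g. (\<forall>x\<in>U. ((\<lambda>t. (x(i := t)) j) has_real_derivative g x) (at (x i))) \<and>
        Ck_on m n U g" for i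
      by (intro exI[of _ "\<lambda>x. if i = j then 1 else 0"] conjI ballI Ck_on_const)
    with cont show ?thesis
      unfolding Suc Ck_on.simps by blast
  qed
qed

lemma (in diffeological_space) plot_restrict:
  assumes "\<alpha> \<in> plots X m U" "euclidean_domain m V" "V \<subseteq> U"
  shows "restrict \<alpha> V \<in> plots X m V"
proof -
  have "smooth_euclidean m V m U (\<lambda>v. v)"
    using assms(3) by (auto simp: smooth_euclidean_def intro: Ck_on_coordinate)
  from plot_comp[OF assms(1,2) this] show ?thesis
    by (simp add: restrict_def)
qed

lemma dsmooth_plot:
  "\<lbrakk>dsmooth X Y f; \<alpha> \<in> plots X m U\<rbrakk> \<Longrightarrow> (\<lambda>u\<in>U. f (\<alpha> u)) \<in> plots Y m U"
  by (auto simp: dsmooth_def)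

lemma dsmooth_pts: "\<lbrakk>dsmooth X Y f; x \<in> pts X\<rbrakk> \<Longrightarrow> f x \<in> pts Y"
  by (auto simp: dsmooth_def)

lemma prod_diff_plot:
  assumes "diffeological_space X" "diffeological_space Y"
    and "\<alpha> \<in> plots X m U" "\<beta> \<in> plots Y m U"
  shows "(\<lambda>u\<in>U. (\<alpha> u, \<beta> u)) \<in> plots (prod_diff X Y) m U"
proof -
  have \<alpha>: "\<alpha> \<in> U \<rightarrow>\<^sub>E pts X" and \<beta>: "\<beta> \<in> U \<rightarrow>\<^sub>E pts Y"
    using assms diffeological_space.plot_fun by blast+
  have "(\<lambda>u\<in>U. fst ((\<lambda>u\<in>U. (\<alpha> u, \<beta> u)) u)) = \<alpha>" "(\<lambda>u\<in>U. snd ((\<lambda>u\<in>U. (\<alpha> u, \<beta> u)) u)) = \<beta>"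
    using \<alpha> \<beta> by (auto simp: fun_eq_iff PiE_def extensional_def)
  with \<alpha> \<beta> assms(3,4) show ?thesis
    by (auto simp: prod_diff_def)
qed

lemma fibred_prod_plot:
  assumes "diffeological_space X" "diffeological_space Y"
    and "\<alpha> \<in> plots X m U" "\<beta> \<in> plots Y m U" "\<And>u. u \<in> U \<Longrightarrow> f (\<alpha> u) = g (\<beta> u)"
  shows "(\<lambda>u\<in>U. (\<alpha> u, \<beta> u)) \<in> plots (fibred_prod X Y f g) m U"
  using prod_diff_plot[OF assms(1-4)] assms(5) by (auto simp: fibred_prod_def sub_diff_def)

lemma fibred_prod_plotD:
  assumes "\<delta> \<in> plots (fibred_prod X Y f g) m U"
  shows "(\<lambda>u\<in>U. fst (\<delta> u)) \<in> plots X m U" "(\<lambda>u\<in>U. snd (\<delta> u)) \<in> plots Y m U"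
    and "\<And>u. u \<in> U \<Longrightarrow> fst (\<delta> u) \<in> pts X" "\<And>u. u \<in> U \<Longrightarrow> snd (\<delta> u) \<in> pts Y"
    and "\<And>u. u \<in> U \<Longrightarrow> f (fst (\<delta> u)) = g (snd (\<delta> u))"
    and "\<And>u. u \<in> U \<Longrightarrow> \<delta> u \<in> pts (fibred_prod X Y f g)"
proof -
  have *: "\<delta> \<in> U \<rightarrow>\<^sub>E pts X \<times> pts Y" "\<delta> ` U \<subseteq> {(x, y). f x = g y}"
    and "(\<lambda>u\<in>U. fst (\<delta> u)) \<in> plots X m U" "(\<lambda>u\<in>U. snd (\<delta> u)) \<in> plots Y m U"
    using assms by (simp_all add: fibred_prod_def sub_diff_def prod_diff_def)
  then show "(\<lambda>u\<in>U. fst (\<delta> u)) \<in> plots X m U" "(\<lambda>u\<in>U. snd (\<delta> u)) \<in> plots Y m U"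
    by blast+
  fix u assume u: "u \<in> U"
  obtain x y where xy: "\<delta> u = (x, y)"
    by (cases "\<delta> u")
  have "(x, y) \<in> pts X \<times> pts Y"
    using PiE_mem[OF *(1) u] by (simp add: xy)
  moreover have "(x, y) \<in> {(x, y). f x = g y}"
    using subsetD[OF *(2) imageI[OF u]] by (simp add: xy)
  ultimately show "fst (\<delta> u) \<in> pts X" "snd (\<delta> u) \<in> pts Y"
    "f (fst (\<delta> u)) = g (snd (\<delta> u))" "\<delta> u \<in> pts (fibred_prod X Y f g)"
    by (simp_all add: xy fibred_prod_def sub_diff_def prod_diff_def)
qed

lemma subduction_lift:
  assumes "subduction X Y f" "\<alpha> \<in> plots Y m U" "t \<in> U"
  obtains V \<beta> where "euclidean_domain m V" "t \<in> V" "V \<subseteq> U" "\<beta> \<in> plots X m V"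
    "\<And>v. v \<in> V \<Longrightarrow> f (\<beta> v) = \<alpha> v"
  using assms unfolding subduction_def by metis

lemma diffeomorphism_lift:
  assumes "diffeomorphism X Y f" "\<beta> \<in> plots Y m U" "\<And>u. u \<in> U \<Longrightarrow> \<beta> u \<in> pts Y"
  obtains \<alpha> where "\<alpha> \<in> plots X m U" "\<And>u. u \<in> U \<Longrightarrow> f (\<alpha> u) = \<beta> u"
proof
  show "(\<lambda>u\<in>U. inv_into (pts X) f (\<beta> u)) \<in> plots X m U"
    using assms dsmooth_plot by (auto simp: diffeomorphism_def)
  show "f ((\<lambda>u\<in>U. inv_into (pts X) f (\<beta> u)) u) = \<beta> u" if "u \<in> U" for u
    using assms that by (auto simp: diffeomorphism_def bij_betw_def intro: f_inv_into_f)
qed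


section \<open>Fibrating groupoids\<close>

context diffeological_groupoid
begin

lemma trg_src_smooth: "dsmooth (Arr G) (prod_diff (Ob G) (Ob G)) (\<lambda>g. (trg G g, src G g))"
  unfolding dsmooth_def
proof (intro conjI allI ballI)
  show "(\<lambda>g. (trg G g, src G g)) \<in> pts (Arr G) \<rightarrow> pts (prod_diff (Ob G) (Ob G))"
    using trg_smooth src_smooth by (auto simp: prod_diff_def dsmooth_pts)
  fix m U \<alpha> assume "\<alpha> \<in> plots (Arr G) m U"
  from prod_diff_plot[OF Ob_diff Ob_diff dsmooth_plot[OF trg_smooth this]
      dsmooth_plot[OF src_smooth this]]
  show "(\<lambda>u\<in>U. (trg G (\<alpha> u), src G (\<alpha> u))) \<in> plots (prod_diff (Ob G) (Ob G)) m U"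
    by (simp cong: restrict_cong)
qed

text \<open>
  The lifting condition of a subduction already forces surjectivity on points, since every constant
  function is a plot.
\<close>

lemma fibratingI:
  assumes lift: "\<And>m U \<alpha> \<beta> t. \<lbrakk>\<alpha> \<in> plots (Ob G) m U; \<beta> \<in> plots (Ob G) m U; t \<in> U\<rbrakk> \<Longrightarrow>
      \<exists>V \<gamma>. euclidean_domain m V \<and> t \<in> V \<and> V \<subseteq> U \<and> \<gamma> \<in> plots (Arr G) m V \<and>
            (\<forall>v\<in>V. trg G (\<gamma> v) = \<alpha> v \<and> src G (\<gamma> v) = \<beta> v)"
  shows "fibrating G"
  unfolding fibrating_def subduction_def
proof (intro conjI allI ballI)
  show "dsmooth (Arr G) (prod_diff (Ob G) (Ob G)) (\<lambda>g. (trg G g, src G g))"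
    by (rule trg_src_smooth)
  show "(\<lambda>g. (trg G g, src G g)) ` pts (Arr G) = pts (prod_diff (Ob G) (Ob G))"
  proof (intro equalityI subsetI)
    fix p assume "p \<in> pts (prod_diff (Ob G) (Ob G))"
    then obtain x y where p: "p = (x, y)" and xy: "x \<in> pts (Ob G)" "y \<in> pts (Ob G)"
      by (auto simp: prod_diff_def)
    \<comment> \<open>Points are plots on \<open>\<real>\<^sup>0\<close>, so surjectivity is an instance of the lifting hypothesis.\<close>
    let ?U = "topspace (Euclidean_space 0)"
    have U: "euclidean_domain 0 ?U" by (rule openin_topspace)
    have t: "(\<lambda>_. 0) \<in> ?U" by (simp add: topspace_Euclidean_space)
    obtain V \<gamma> where V: "(\<lambda>_. 0) \<in> V" "V \<subseteq> ?U" and \<gamma>: "\<gamma> \<in> plots (Arr G) 0 V"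
      and eq: "\<forall>v\<in>V. trg G (\<gamma> v) = (\<lambda>u\<in>?U. x) v \<and> src G (\<gamma> v) = (\<lambda>u\<in>?U. y) v"
      using lift[OF diffeological_space.plot_const[OF Ob_diff U xy(1)]
          diffeological_space.plot_const[OF Ob_diff U xy(2)] t] by blast
    have "\<gamma> (\<lambda>_. 0) \<in> pts (Arr G)"
      using diffeological_space.plot_fun[OF Arr_diff \<gamma>] V by blast
    moreover have "p = (trg G (\<gamma> (\<lambda>_. 0)), src G (\<gamma> (\<lambda>_. 0)))"
      using V t eq p by (metis (no_types, lifting) restrict_apply')
    ultimately show "p \<in> (\<lambda>g. (trg G g, src G g)) ` pts (Arr G)"
      by blast
  qed (use trg_src_smooth in \<open>auto simp: dsmooth_def\<close>)
  fix m U \<alpha> t assume \<alpha>: "\<alpha> \<in> plots (prod_diff (Ob G) (Ob G)) m U" and t: "t \<in> U"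
  then have "(\<lambda>u\<in>U. fst (\<alpha> u)) \<in> plots (Ob G) m U" "(\<lambda>u\<in>U. snd (\<alpha> u)) \<in> plots (Ob G) m U"
    by (auto simp: prod_diff_def)
  from lift[OF this t] show "\<exists>V \<beta>. euclidean_domain m V \<and> t \<in> V \<and> V \<subseteq> U \<and>
      \<beta> \<in> plots (Arr G) m V \<and> (\<forall>v\<in>V. \<alpha> v = (trg G (\<beta> v), src G (\<beta> v)))"
    by (smt (verit) prod.collapse restrict_apply' subsetD)
qed

lemma fibrating_lift:
  assumes "fibrating G" "\<alpha> \<in> plots (Ob G) m U" "\<beta> \<in> plots (Ob G) m U" "t \<in> U"
  obtains V \<gamma> where "euclidean_domain m V" "t \<in> V" "V \<subseteq> U" "\<gamma> \<in> plots (Arr G) m V"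
    "\<And>v. v \<in> V \<Longrightarrow> trg G (\<gamma> v) = \<alpha> v" "\<And>v. v \<in> V \<Longrightarrow> src G (\<gamma> v) = \<beta> v"
proof -
  obtain V \<gamma> where *: "euclidean_domain m V" "t \<in> V" "V \<subseteq> U" "\<gamma> \<in> plots (Arr G) m V"
    and "\<And>v. v \<in> V \<Longrightarrow> (trg G (\<gamma> v), src G (\<gamma> v)) = (\<lambda>u\<in>U. (\<alpha> u, \<beta> u)) v"
    by (rule subduction_lift[OF assms(1)[unfolded fibrating_def]
          prod_diff_plot[OF Ob_diff Ob_diff assms(2,3)] assms(4)]) (rule that)
  then have "\<And>v. v \<in> V \<Longrightarrow> trg G (\<gamma> v) = \<alpha> v" "\<And>v. v \<in> V \<Longrightarrow> src G (\<gamma> v) = \<beta> v"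
    by (auto simp: subset_iff)
  with * show thesis by (rule that)
qed

end

text \<open>
  The hypotheses abstract what the two sides of a biprincipal bibundle have in common. The
  hypothesis \<open>move\<close> stands for the action of \<open>G\<close>, and \<open>divide\<close> for principality of the
  action of \<open>H\<close>; neither mentions an action, so the side on which each groupoid acts is
  immaterial.
\<close>

lemma fibrating_transfer:
  assumes G: "diffeological_groupoid G" and H: "diffeological_groupoid H"
    and X: "diffeological_space X"
    and l: "dsmooth X (Ob G) l" and r: "subduction X (Ob H) r"
    and move: "\<And>m U g b. \<lbrakk>g \<in> plots (Arr G) m U; b \<in> plots X m U;
        \<And>u. u \<in> U \<Longrightarrow> src G (g u) = l (b u)\<rbrakk> \<Longrightarrow>
        \<exists>c\<in>plots X m U. \<forall>u\<in>U. l (c u) = trg G (g u) \<and> r (c u) = r (b u)"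
    and divide: "\<And>m U a c. \<lbrakk>a \<in> plots X m U; c \<in> plots X m U;
        \<And>u. u \<in> U \<Longrightarrow> l (a u) = l (c u)\<rbrakk> \<Longrightarrow>
        \<exists>h\<in>plots (Arr H) m U. \<forall>u\<in>U. trg H (h u) = r (a u) \<and> src H (h u) = r (c u)"
    and "fibrating G"
  shows "fibrating H"
proof -
  interpret G: diffeological_groupoid G by (rule G)
  interpret H: diffeological_groupoid H by (rule H)
  interpret X: diffeological_space X by (rule X)
  interpret B: diffeological_space "Ob H" by (rule H.Ob_diff)
  show ?thesis
  proof (rule H.fibratingI)
    fix m U \<alpha> \<beta> t
    assume \<alpha>: "\<alpha> \<in> plots (Ob H) m U" and \<beta>: "\<beta> \<in> plots (Ob H) m U" and t: "t \<in> U"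
    obtain V a where V: "euclidean_domain m V" "t \<in> V" "V \<subseteq> U" and a: "a \<in> plots X m V"
      and ra: "\<And>v. v \<in> V \<Longrightarrow> r (a v) = \<alpha> v"
      by (rule subduction_lift[OF r \<alpha> t]) (rule that)
    obtain W b where W: "euclidean_domain m W" "t \<in> W" "W \<subseteq> V" and b: "b \<in> plots X m W"
      and rb: "\<And>w. w \<in> W \<Longrightarrow> r (b w) = restrict \<beta> V w"
      by (rule subduction_lift[OF r B.plot_restrict[OF \<beta> V(1,3)] V(2)]) (rule that)
    obtain N g where N: "euclidean_domain m N" "t \<in> N" "N \<subseteq> W" and g: "g \<in> plots (Arr G) m N"
      and trg: "\<And>u. u \<in> N \<Longrightarrow> trg G (g u) = (\<lambda>w\<in>W. l (restrict a W w)) u"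
      and src: "\<And>u. u \<in> N \<Longrightarrow> src G (g u) = (\<lambda>w\<in>W. l (b w)) u"
      by (rule G.fibrating_lift[OF \<open>fibrating G\<close> dsmooth_plot[OF l X.plot_restrict[OF a W(1,3)]]
          dsmooth_plot[OF l b] W(2)]) (rule that)
    obtain c where c: "c \<in> plots X m N"
      and lc: "\<forall>u\<in>N. l (c u) = trg G (g u) \<and> r (c u) = r (restrict b N u)"
      using move[OF g X.plot_restrict[OF b N(1,3)]] src N(3) by (auto simp: subset_iff)
    obtain h where h: "h \<in> plots (Arr H) m N"
      and eq: "\<forall>u\<in>N. trg H (h u) = r (restrict a N u) \<and> src H (h u) = r (c u)"
      using divide[OF X.plot_restrict[OF a N(1)] c] lc trg N(3) W(3) by (auto simp: subset_iff)
    have "\<forall>u\<in>N. trg H (h u) = \<alpha> u \<and> src H (h u) = \<beta> u"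
      using eq ra rb lc N(3) W(3) by (auto simp: subset_iff)
    with N W(3) V(3) h show "\<exists>V \<gamma>. euclidean_domain m V \<and> t \<in> V \<and> V \<subseteq> U \<and>
        \<gamma> \<in> plots (Arr H) m V \<and> (\<forall>v\<in>V. trg H (\<gamma> v) = \<alpha> v \<and> src H (\<gamma> v) = \<beta> v)"
      by blast
  qed
qed


section \<open>Biprincipal bibundles\<close>

context bibundle
begin

lemma left_move:
  assumes g: "g \<in> plots (Arr G) m U" and b: "b \<in> plots X m U"
    and eq: "\<And>u. u \<in> U \<Longrightarrow> src G (g u) = l (b u)"
  shows "\<exists>c\<in>plots X m U. \<forall>u\<in>U. l (c u) = trg G (g u) \<and> r (c u) = r (b u)"
proof
  have pts: "g u \<in> pts (Arr G)" "b u \<in> pts X" if "u \<in> U" for u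
    using diffeological_space.plot_fun[OF left.Arr_diff g] left.plot_fun[OF b] that by auto
  have "(\<lambda>u\<in>U. (g u, b u)) \<in> plots (fibred_prod (Arr G) X (src G) l) m U"
    by (rule fibred_prod_plot) (use left.Arr_diff left.diffeological_space_axioms g b eq in auto)
  from dsmooth_plot[OF left.act_smooth this]
  show "(\<lambda>u\<in>U. lact (g u) (b u)) \<in> plots X m U"
    by (simp cong: restrict_cong)
  show "\<forall>u\<in>U. l ((\<lambda>u\<in>U. lact (g u) (b u)) u) = trg G (g u) \<and>
      r ((\<lambda>u\<in>U. lact (g u) (b u)) u) = r (b u)"
    using pts eq by (simp add: left.moment_act right_moment_invariant)
qed

text \<open>
  The right action moves a point from the target of an arrow to its source, whereas
  \<open>fibrating_transfer\<close> asks for the opposite direction; hence the point is moved along the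
  inverse arrow.
\<close>

lemma right_move:
  assumes h: "h \<in> plots (Arr H) m U" and b: "b \<in> plots X m U"
    and eq: "\<And>u. u \<in> U \<Longrightarrow> src H (h u) = r (b u)"
  shows "\<exists>c\<in>plots X m U. \<forall>u\<in>U. r (c u) = trg H (h u) \<and> l (c u) = l (b u)"
proof
  have pts: "h u \<in> pts (Arr H)" "b u \<in> pts X" if "u \<in> U" for u
    using diffeological_space.plot_fun[OF right.Arr_diff h] left.plot_fun[OF b] that by auto
  then have inv: "ginv H (h u) \<in> pts (Arr H)" "r (b u) = trg H (ginv H (h u))" if "u \<in> U" for u
    using that eq by (auto simp: right.trg_inv intro: dsmooth_pts[OF right.inv_smooth])
  have "(\<lambda>u\<in>U. (b u, (\<lambda>u\<in>U. ginv H (h u)) u)) \<in> plots (fibred_prod X (Arr H) r (trg H)) m U"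
    by (rule fibred_prod_plot[OF left.diffeological_space_axioms right.Arr_diff b
          dsmooth_plot[OF right.inv_smooth h]]) (simp add: inv)
  from dsmooth_plot[OF right.act_smooth this]
  show "(\<lambda>u\<in>U. ract (b u) (ginv H (h u))) \<in> plots X m U"
    by (simp cong: restrict_cong)
  show "\<forall>u\<in>U. r ((\<lambda>u\<in>U. ract (b u) (ginv H (h u))) u) = trg H (h u) \<and>
      l ((\<lambda>u\<in>U. ract (b u) (ginv H (h u))) u) = l (b u)"
    using pts inv by (simp add: right.moment_act left_moment_invariant right.src_inv)
qed

end

context biprincipal_bibundle
begin

text \<open>
  The inverse of the diffeomorphism \<open>(x, h) \<mapsto> (x, x h)\<close> sends \<open>(a, c)\<close> to the pair of \<open>a\<close> and the
  unique \<open>h\<close> with \<open>a h = c\<close>. It is smooth, so dividing one plot by another pointwise gives a plot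
  of arrows. The left action is treated in the same way with \<open>g c = a\<close>.
\<close>

lemma right_divide:
  assumes a: "a \<in> plots X m U" and c: "c \<in> plots X m U"
    and eq: "\<And>u. u \<in> U \<Longrightarrow> l (a u) = l (c u)"
  shows "\<exists>h\<in>plots (Arr H) m U. \<forall>u\<in>U. trg H (h u) = r (a u) \<and> src H (h u) = r (c u)"
proof -
  have pair: "(\<lambda>u\<in>U. (a u, c u)) \<in> plots (fibred_prod X X l l) m U"
    by (rule fibred_prod_plot) (use left.diffeological_space_axioms a c eq in auto)
  obtain \<delta> where \<delta>: "\<delta> \<in> plots (fibred_prod X (Arr H) r (trg H)) m U"
    and div: "\<And>u. u \<in> U \<Longrightarrow> (\<lambda>(x, h). (x, ract x h)) (\<delta> u) = (\<lambda>u\<in>U. (a u, c u)) u"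
    by (rule diffeomorphism_lift[OF right_principal pair])
      (rule fibred_prod_plotD(6)[OF pair], assumption, rule that)
  have "a u = fst (\<delta> u)" "c u = ract (fst (\<delta> u)) (snd (\<delta> u))" if "u \<in> U" for u
    using div[OF that] that by (auto simp: case_prod_beta)
  with fibred_prod_plotD[OF \<delta>] show ?thesis
    by (intro bexI[OF _ fibred_prod_plotD(2)[OF \<delta>]]) (simp add: right.moment_act)
qed

lemma left_divide:
  assumes a: "a \<in> plots X m U" and c: "c \<in> plots X m U"
    and eq: "\<And>u. u \<in> U \<Longrightarrow> r (a u) = r (c u)"
  shows "\<exists>g\<in>plots (Arr G) m U. \<forall>u\<in>U. trg G (g u) = l (a u) \<and> src G (g u) = l (c u)"
proof -
  have pair: "(\<lambda>u\<in>U. (a u, c u)) \<in> plots (fibred_prod X X r r) m U"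
    by (rule fibred_prod_plot) (use left.diffeological_space_axioms a c eq in auto)
  obtain \<delta> where \<delta>: "\<delta> \<in> plots (fibred_prod (Arr G) X (src G) l) m U"
    and div: "\<And>u. u \<in> U \<Longrightarrow> (\<lambda>(g, x). (lact g x, x)) (\<delta> u) = (\<lambda>u\<in>U. (a u, c u)) u"
    by (rule diffeomorphism_lift[OF left_principal pair])
      (rule fibred_prod_plotD(6)[OF pair], assumption, rule that)
  have "a u = lact (fst (\<delta> u)) (snd (\<delta> u))" "c u = snd (\<delta> u)" if "u \<in> U" for u
    using div[OF that] that by (auto simp: case_prod_beta)
  with fibred_prod_plotD[OF \<delta>] show ?thesis
    by (intro bexI[OF _ fibred_prod_plotD(1)[OF \<delta>]]) (simp add: left.moment_act)
qed

lemma fibrating_iff: "fibrating G \<longleftrightarrow> fibrating H"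
proof
  assume "fibrating G"
  with left.moment_smooth right_subduction left_move right_divide show "fibrating H"
    by (rule fibrating_transfer[OF left.diffeological_groupoid_axioms
          right.diffeological_groupoid_axioms left.diffeological_space_axioms])
next
  assume "fibrating H"
  with right.moment_smooth left_subduction right_move left_divide show "fibrating G"
    by (rule fibrating_transfer[OF right.diffeological_groupoid_axioms
          left.diffeological_groupoid_axioms left.diffeological_space_axioms])
qed

end

theorem theorem6p3:
  fixes G :: "('g0, 'g) groupoid" and H :: "('h0, 'h) groupoid"
  assumes "diffeological_groupoid G" and "diffeological_groupoid H"
    and "morita_equivalent TYPE('x) G H"
  shows "fibrating G \<longleftrightarrow> fibrating H"
proof -
  obtain X :: "'x diffeology" and l lact r ract
    where "biprincipal_bibundle G H X l lact r ract"
    using assms(3) unfolding morita_equivalent_def by blast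
  then show ?thesis
    by (rule biprincipal_bibundle.fibrating_iff)
qed

end
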